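(* Let $n,l,m\ge 1$, let $I=\{1,\dots,n\}$, let $x_i\in\mathbb{R}^l$ and $y_i\in\mathbb{R}^m$ be componentwise strictly positive vectors for every $i\in I$, let $o\in I$, and let $\alpha\ge 0$. Then the optimal value of the linear program $$\begin{array}{ll}\text{maximize} & y_o^{\top}v-\alpha t'\\ \text{subject to} & x_o^{\top}u'=t',\\ & y_o^{\top}v\le 1,\\ & y_i^{\top}v\le x_i^{\top}u'\quad\forall i\in I\setminus\{o\},\\ & u'\ge 0,\ v\ge 0,\ 0\le t'\le 1\end{array}$$ in the variables $u'\in\mathbb{R}^l$, $v\in\mathbb{R}^m$, $t'\in\mathbb{R}$ lies in $[0,1]$.
   Context: There are $n$ decision making units (DMUs); DMU $i$ has input vector $x_i\in\mathbb{R}^l$ and output vector $y_i\in\mathbb{R}^m$, and $o$ is the DMU being evaluated. The linear program is the MM-DEA (Maximum-Margin Data Envelopment Analysis) model in linear programming form, with trade-off parameter $\alpha$; its optimal value is the MM-DEA score of DMU $o$. Vector inequalities are componentwise. *)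

theory Defs
  imports "HOL-Analysis.Analysis" "HOL-Library.Extended_Real"
begin

text \<open>
  The DMUs are indexed by \<open>{1..n}\<close>, and \<open>k\<close> is the DMU under evaluation (the letter \<open>o\<close> is
  reserved syntax for composition). A triple \<open>(u, v, t)\<close> holds the decision variables
  \<open>u'\<close>, \<open>v\<close>, \<open>t'\<close>. The order on \<^typ>\<open>real ^ 'a\<close> is componentwise.
\<close>

definition mmdea_feasible ::
  "nat \<Rightarrow> (nat \<Rightarrow> real ^ 'l::finite) \<Rightarrow> (nat \<Rightarrow> real ^ 'm::finite) \<Rightarrow> nat
    \<Rightarrow> ((real ^ 'l) \<times> (real ^ 'm) \<times> real) set" where
  "mmdea_feasible n x y k =
    {(u, v, t). x k \<bullet> u = t
              \<and> y k \<bullet> v \<le> 1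
              \<and> (\<forall>i \<in> {1..n} - {k}. y i \<bullet> v \<le> x i \<bullet> u)
              \<and> 0 \<le> u \<and> 0 \<le> v \<and> 0 \<le> t \<and> t \<le> 1}"

definition mmdea_objective ::
  "(nat \<Rightarrow> real ^ 'm::finite) \<Rightarrow> nat \<Rightarrow> real \<Rightarrow> ((real ^ 'l::finite) \<times> (real ^ 'm) \<times> real) \<Rightarrow> real" where
  "mmdea_objective y k \<alpha> = (\<lambda>(u, v, t). y k \<bullet> v - \<alpha> * t)"

definition mmdea_optimal_solution ::
  "nat \<Rightarrow> (nat \<Rightarrow> real ^ 'l::finite) \<Rightarrow> (nat \<Rightarrow> real ^ 'm::finite) \<Rightarrow> nat \<Rightarrow> real
    \<Rightarrow> ((real ^ 'l) \<times> (real ^ 'm) \<times> real) \<Rightarrow> bool" where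
  "mmdea_optimal_solution n x y k \<alpha> z \<longleftrightarrow>
    z \<in> mmdea_feasible n x y k \<and>
    (\<forall>z' \<in> mmdea_feasible n x y k. mmdea_objective y k \<alpha> z' \<le> mmdea_objective y k \<alpha> z)"

text \<open>
  The supremum is taken in the extended reals, so that an infeasible program has value \<open>-\<infinity>\<close>
  and an unbounded one \<open>\<infinity>\<close>, rather than an unspecified real number.
\<close>

definition mmdea_optimal_value ::
  "nat \<Rightarrow> (nat \<Rightarrow> real ^ 'l::finite) \<Rightarrow> (nat \<Rightarrow> real ^ 'm::finite) \<Rightarrow> nat \<Rightarrow> real \<Rightarrow> ereal" where
  "mmdea_optimal_value n x y k \<alpha> =
    (SUP z \<in> mmdea_feasible n x y k. ereal (mmdea_objective y k \<alpha> z))"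

end

theory Submission
  imports Defs
begin

text \<open>
  Positivity of the data turns \<open>x k \<bullet> u \<le> 1\<close> and \<open>y k \<bullet> v \<le> 1\<close> into coordinatewise bounds, so
  the feasible region is compact and the maximum is attained. The origin is feasible with
  objective value \<open>0\<close>, and \<open>y k \<bullet> v \<le> 1\<close> bounds the objective above.
\<close>

text \<open>Every summand of the inner product is nonnegative, so a single
  \<open>a $ j * w $ j\<close> cannot exceed the whole sum.\<close>

lemma vec_le_if_inner_le_1:
  fixes a w :: "real ^ 'a::finite"
  assumes "\<forall>j. a $ j > 0" "0 \<le> w" "a \<bullet> w \<le> 1"
  shows "w \<le> (\<chi> j. 1 / a $ j)"
proof -
  have w: "0 \<le> w $ j" for j
    using assms(2) by (simp add: less_eq_vec_def)
  have "w $ j \<le> 1 / a $ j" for j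
  proof -
    have "a $ j * w $ j \<le> (\<Sum>i\<in>UNIV. a $ i * w $ i)"
      by (rule member_le_sum) (use assms(1) w in \<open>auto simp: less_imp_le\<close>)
    also have "\<dots> = a \<bullet> w"
      by (simp add: inner_vec_def)
    finally show ?thesis
      using assms(1,3) by (simp add: pos_le_divide_eq mult.commute)
  qed
  then show ?thesis
    by (simp add: less_eq_vec_def)
qed

text \<open>Non-strict relations between continuous functions cut out closed sets, and closedness
  survives intersection. The guard on \<open>i\<close> does not depend on the point, so it defines
  an open set, as \<open>closed_Collect_imp\<close> requires.\<close>

lemma closed_mmdea_feasible: "closed (mmdea_feasible n x y k)"
  unfolding mmdea_feasible_def case_prod_beta less_eq_vec_def Ball_def
  by (intro closed_Collect_conj closed_Collect_all closed_Collect_imp closed_Collect_eq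
      closed_Collect_le open_Collect_const continuous_intros)

lemma bounded_mmdea_feasible:
  assumes "\<forall>j. x k $ j > 0" "\<forall>j. y k $ j > 0"
  shows "bounded (mmdea_feasible n x y k)"
proof (rule bounded_subset)
  show "bounded ({0..\<chi> j. 1 / x k $ j} \<times> {0..\<chi> j. 1 / y k $ j} \<times> {0..1::real})"
    by (intro bounded_Times) (auto simp flip: interval_cbox)
  \<comment> \<open>The box for \<open>u\<close> comes from \<open>x k \<bullet> u = t\<close>
    together with \<open>t \<le> 1\<close>.\<close>
  show "mmdea_feasible n x y k \<subseteq> {0..\<chi> j. 1 / x k $ j} \<times> {0..\<chi> j. 1 / y k $ j} \<times> {0..1}"
    unfolding mmdea_feasible_def using assms by (auto intro!: vec_le_if_inner_le_1)
qed

theorem mainTheorem3: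
  fixes n k :: nat
    and x :: "nat \<Rightarrow> real ^ 'l::finite"
    and y :: "nat \<Rightarrow> real ^ 'm::finite"
    and \<alpha> :: real
  assumes "n \<ge> 1"
    and "\<forall>i \<in> {1..n}. \<forall>j. x i $ j > 0"
    and "\<forall>i \<in> {1..n}. \<forall>j. y i $ j > 0"
    and "k \<in> {1..n}"
    and "\<alpha> \<ge> 0"
  shows "(\<exists>z. mmdea_optimal_solution n x y k \<alpha> z) \<and> mmdea_optimal_value n x y k \<alpha> \<in> {0..1}"
proof -
  let ?F = "mmdea_feasible n x y k"
  let ?f = "mmdea_objective y k \<alpha>"
  have zero: "(0, 0, 0) \<in> ?F"
    by (simp add: mmdea_feasible_def)
  have "compact ?F"
    unfolding compact_eq_bounded_closed using assms(2-4)
    by (intro conjI bounded_mmdea_feasible closed_mmdea_feasible) auto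
  moreover have "continuous_on ?F ?f"
    unfolding mmdea_objective_def case_prod_beta by (intro continuous_intros)
  ultimately obtain z where z: "z \<in> ?F" "\<forall>z' \<in> ?F. ?f z' \<le> ?f z"
    using continuous_attains_sup[of ?F ?f] zero by blast
  \<comment> \<open>An attained maximum is the supremum, so the extended real value is
    finite.\<close>
  have "mmdea_optimal_value n x y k \<alpha> = ereal (?f z)"
    unfolding mmdea_optimal_value_def by (rule SUP_eqI) (use z in auto)
  moreover have "0 \<le> ?f z"
    using z(2) zero by (force simp: mmdea_objective_def)
  moreover have "?f z \<le> 1"
  proof -
    obtain u v t where "z = (u, v, t)"
      by (cases z)
    then have "y k \<bullet> v \<le> 1" "0 \<le> t" "?f z = y k \<bullet> v - \<alpha> * t"
      using z(1) by (auto simp: mmdea_feasible_def mmdea_objective_def)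
    moreover have "0 \<le> \<alpha> * t"
      using assms(5) \<open>0 \<le> t\<close> by simp
    ultimately show ?thesis
      by linarith
  qed
  moreover have "mmdea_optimal_solution n x y k \<alpha> z"
    using z by (simp add: mmdea_optimal_solution_def)
  \<comment> \<open>Splitting the existential into three components would hide the witness
    \<open>z\<close> from \<open>blast\<close>.\<close>
  ultimately show ?thesis
    by (simp del: split_paired_Ex) blast
qed

end
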